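(* For every $n\ge 1$, the set $\mathcal{U}_n$ of unimodal permutations in $\mathcal{S}_n$ satisfies $$\mathcal{U}_n=\mathcal{A}_n(2143,3412)=\mathcal{S}_n(1324,1342,2143,2413,2431,3124,3142,3412,4213,4231).$$
   Context: Permutations $\pi\in\mathcal{S}_n$ are written in one-line notation. An interval in $\mathbb{Z}$ is a set $[a,b]=\{a,a+1,\dots,b\}$ with $a\le b$. An interval in $\mathbb{Z}_n$ is a subset of $\{1,\dots,n\}$ of the form $[a,b]$ or $[b,n]\cup[1,a]$ for some $1\le a\le b\le n$. A permutation $\pi\in\mathcal{S}_n$ is unimodal if either (i) for every $1\le j\le n$ the set of letters of the prefix $\pi(1)\cdots\pi(j)$ is an interval in $\mathbb{Z}$, or (ii) for every $1\le j\le n$ the set of letters of the suffix $\pi(j)\cdots\pi(n)$ is an interval in $\mathbb{Z}$. $\mathcal{U}_n$ is the set of unimodal permutations in $\mathcal{S}_n$. A permutation is an arc permutation if for every $1\le j\le n$ the set $\{\pi(1),\dots,\pi(j)\}$ is an interval in $\mathbb{Z}_n$; $\mathcal{A}_n$ is the set of arc permutations in $\mathcal{S}_n$. For patterns $\tau_1,\tau_2,\dots$, $\mathcal{S}_n(\tau_1,\tau_2,\dots)$ (resp. $\mathcal{A}_n(\tau_1,\tau_2,\dots)$) denotes the set of permutations in $\mathcal{S}_n$ (resp. $\mathcal{A}_n$) that avoid all of the $\tau_i$, i.e. contain no (not necessarily contiguous) subsequence whose entries are in the same relative order as those of $\tau_i$. *)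

theory Defs
  imports "HOL-Combinatorics.Permutations"
begin

(* A permutation of [n] is a function permuting {1..n} (the identity elsewhere);
   its one-line notation is the word p 1, ..., p n. *)
definition Perms :: "nat \<Rightarrow> (nat \<Rightarrow> nat) set" where
  "Perms n = {p. p permutes {1..n}}"

(* Letters are natural numbers, and a nonempty set of naturals that is an
   integer interval has natural endpoints, so nat endpoints lose nothing. *)
definition Z_interval :: "nat set \<Rightarrow> bool" where
  "Z_interval A \<longleftrightarrow> (\<exists>a b. a \<le> b \<and> A = {a..b})"

(* The cyclic group of order n has representatives 1, ..., n. *)
definition Zn_interval :: "nat \<Rightarrow> nat set \<Rightarrow> bool" where
  "Zn_interval n A \<longleftrightarrow>
     (\<exists>a b. 1 \<le> a \<and> a \<le> b \<and> b \<le> n \<and> (A = {a..b} \<or> A = {b..n} \<union> {1..a}))"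

definition unimodal_perms :: "nat \<Rightarrow> (nat \<Rightarrow> nat) set" where
  "unimodal_perms n =
     {p \<in> Perms n. (\<forall>j\<in>{1..n}. Z_interval (p ` {1..j})) \<or>
                   (\<forall>j\<in>{1..n}. Z_interval (p ` {j..n}))}"

definition arc_perms :: "nat \<Rightarrow> (nat \<Rightarrow> nat) set" where
  "arc_perms n = {p \<in> Perms n. \<forall>j\<in>{1..n}. Zn_interval n (p ` {1..j})}"

(* A pattern t is given as a word in one-line notation; i maps the (0-based)
   positions of t to the positions in {1..n} of an occurrence of t in p. *)
definition contains_pattern :: "nat \<Rightarrow> (nat \<Rightarrow> nat) \<Rightarrow> nat list \<Rightarrow> bool" where
  "contains_pattern n p t \<longleftrightarrow>
     (\<exists>i. strict_mono_on {..<length t} i \<and> i ` {..<length t} \<subseteq> {1..n} \<and>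
          (\<forall>a<length t. \<forall>b<length t. p (i a) < p (i b) \<longleftrightarrow> t ! a < t ! b))"

definition Perms_avoiding :: "nat \<Rightarrow> nat list set \<Rightarrow> (nat \<Rightarrow> nat) set" where
  "Perms_avoiding n T = {p \<in> Perms n. \<forall>t\<in>T. \<not> contains_pattern n p t}"

definition arc_perms_avoiding :: "nat \<Rightarrow> nat list set \<Rightarrow> (nat \<Rightarrow> nat) set" where
  "arc_perms_avoiding n T = {p \<in> arc_perms n. \<forall>t\<in>T. \<not> contains_pattern n p t}"

end

theory Submission
  imports Defs
begin

text \<open>
  All prefixes of a permutation are integer intervals iff no letter lies strictly between two
  earlier letters, all suffixes are iff no letter lies strictly between two later ones, and all
  prefixes are cyclic intervals iff two letters never interlace with two later letters. The last
  condition is avoidance of the eight patterns other than 2143 and 3412.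

  For the nontrivial inclusion, suppose that some letter lies between two earlier ones and that
  some letter \<open>p a\<close> lies between two later ones. Among all \<open>i < j < k\<close> with \<open>p k\<close> between \<open>p i\<close> and
  \<open>p j\<close> take one with \<open>j\<close> minimal, say with \<open>p i < p k < p j\<close>. Minimality makes every letter before
  position \<open>j\<close> smaller than every letter from \<open>j\<close> on; noninterlacing forces \<open>a < j\<close>. A later letter
  \<open>p d < p a\<close> then has \<open>d < j\<close>, so \<open>a, d, j, k\<close> is an occurrence of 2143. Reversing the order of the
  letters turns this into 3412.
\<close>

section \<open>Letters between two earlier or two later letters, and interlacing pairs\<close>

definition last_between :: "nat \<Rightarrow> (nat \<Rightarrow> 'a::linorder) \<Rightarrow> bool" where
  "last_between n f \<longleftrightarrow>
     (\<exists>i j k. 1 \<le> i \<and> i < j \<and> j < k \<and> k \<le> n \<and> (f i < f k \<and> f k < f j \<or> f j < f k \<and> f k < f i))"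

definition first_between :: "nat \<Rightarrow> (nat \<Rightarrow> 'a::linorder) \<Rightarrow> bool" where
  "first_between n f \<longleftrightarrow>
     (\<exists>i j k. 1 \<le> i \<and> i < j \<and> j < k \<and> k \<le> n \<and> (f j < f i \<and> f i < f k \<or> f k < f i \<and> f i < f j))"

text \<open>The definition orders the positions and leaves the letters in two cases. Here the
  letters are ordered and the two earlier positions may come in either order; they differ because
  their letters do.\<close>

lemma last_betweenI:
  assumes "1 \<le> i" "1 \<le> j" "i < k" "j < k" "k \<le> n" "f i < f k" "f k < f j"
  shows "last_between n f"
proof (cases i j rule: linorder_cases)
  case less
  with assms show ?thesis unfolding last_between_def by blast
next
  case greater
  with assms show ?thesis unfolding last_between_def by blast
qed (use assms in auto)

lemma first_betweenI:
  assumes "1 \<le> i" "i < j" "i < k" "j \<le> n" "k \<le> n" "f j < f i" "f i < f k"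
  shows "first_between n f"
proof (cases j k rule: linorder_cases)
  case less
  with assms show ?thesis unfolding first_between_def by blast
next
  case greater
  with assms show ?thesis unfolding first_between_def by blast
qed (use assms in auto)

text \<open>The order inside each of the position pairs \<open>w\<close>, \<open>x\<close> and
  \<open>y\<close>, \<open>z\<close> is left open; the two clauses differ in which pair owns the
  smallest letter. Letters range over any linear order, so that the notion also applies to a negated
  permutation.\<close>

definition noncrossing :: "nat \<Rightarrow> (nat \<Rightarrow> 'a::linorder) \<Rightarrow> bool" where
  "noncrossing n f \<longleftrightarrow>
     (\<forall>w x y z. 1 \<le> w \<and> 1 \<le> x \<and> y \<le> n \<and> z \<le> n \<and> w < y \<and> w < z \<and> x < y \<and> x < z \<longrightarrow>
        \<not> (f w < f y \<and> f y < f x \<and> f x < f z) \<and> \<not> (f y < f w \<and> f w < f z \<and> f z < f x))"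

lemma noncrossingD:
  assumes "noncrossing n f" "1 \<le> w" "1 \<le> x" "y \<le> n" "z \<le> n" "w < y" "w < z" "x < y" "x < z"
  shows "\<not> (f w < f y \<and> f y < f x \<and> f x < f z)" "\<not> (f y < f w \<and> f w < f z \<and> f z < f x)"
  using assms unfolding noncrossing_def by blast+

section \<open>Occurrences of patterns of length four\<close>

lemma contains_pattern_4E:
  assumes "contains_pattern n p [a, b, c, d]"
  obtains w x y z where "1 \<le> w" "w < x" "x < y" "y < z" "z \<le> n"
    "p w < p x \<longleftrightarrow> a < b" "p w < p y \<longleftrightarrow> a < c" "p w < p z \<longleftrightarrow> a < d"
    "p x < p w \<longleftrightarrow> b < a" "p x < p y \<longleftrightarrow> b < c" "p x < p z \<longleftrightarrow> b < d"
    "p y < p w \<longleftrightarrow> c < a" "p y < p x \<longleftrightarrow> c < b" "p y < p z \<longleftrightarrow> c < d"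
    "p z < p w \<longleftrightarrow> d < a" "p z < p x \<longleftrightarrow> d < b" "p z < p y \<longleftrightarrow> d < c"
proof -
  have len: "length [a, b, c, d] = 4" by simp
  obtain i where i: "strict_mono_on {..<4} i" "i ` {..<4} \<subseteq> {1..n}"
    "\<forall>u<4. \<forall>v<4. p (i u) < p (i v) \<longleftrightarrow> [a, b, c, d] ! u < [a, b, c, d] ! v"
    using assms unfolding contains_pattern_def len by blast
  have ord: "i 0 < i 1" "i 1 < i 2" "i 2 < i 3"
    by (auto intro: strict_mono_onD[OF i(1)])
  have "i 0 \<in> {1..n}" "i 3 \<in> {1..n}"
    by (rule subsetD[OF i(2)], simp)+
  then have bounds: "1 \<le> i 0" "i 3 \<le> n" by simp_all
  show thesis
    by (rule that[OF bounds(1) ord bounds(2)]) (simp_all add: i(3)[rule_format])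
qed

text \<open>All twelve comparisons are kept as equivalences: once \<open>a\<close>,
  \<open>b\<close>, \<open>c\<close>, \<open>d\<close> are numerals, the simplifier decides each
  right-hand side.\<close>

lemma contains_pattern_4I:
  assumes ord: "1 \<le> w" "w < x" "x < y" "y < z" "z \<le> n"
    and iff:
    "p w < p x \<longleftrightarrow> a < b" "p w < p y \<longleftrightarrow> a < c" "p w < p z \<longleftrightarrow> a < d"
    "p x < p w \<longleftrightarrow> b < a" "p x < p y \<longleftrightarrow> b < c" "p x < p z \<longleftrightarrow> b < d"
    "p y < p w \<longleftrightarrow> c < a" "p y < p x \<longleftrightarrow> c < b" "p y < p z \<longleftrightarrow> c < d"
    "p z < p w \<longleftrightarrow> d < a" "p z < p x \<longleftrightarrow> d < b" "p z < p y \<longleftrightarrow> d < c"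
  shows "contains_pattern n p [a, b, c, d]"
proof -
  define i where "i = (!) [w, x, y, z]"
  have len: "length [a, b, c, d] = 4" by simp
  have four: "u = 0 \<or> u = 1 \<or> u = 2 \<or> u = 3" if "u < 4" for u :: nat
    using that by linarith
  have i: "i 0 = w" "i 1 = x" "i 2 = y" "i 3 = z" by (simp_all add: i_def)
  have "strict_mono_on {..<4} i"
  proof (rule strict_mono_onI)
    fix u v :: nat assume "u \<in> {..<4}" "v \<in> {..<4}" "u < v"
    then have "u = 0 \<or> u = 1 \<or> u = 2 \<or> u = 3" "v = 0 \<or> v = 1 \<or> v = 2 \<or> v = 3" "u < v"
      by (simp_all only: four lessThan_iff)
    \<comment> \<open>Simplification turns the position \<open>1\<close> into \<open>Suc 0\<close>,
      so the values of \<open>i\<close> are supplied in both forms.\<close>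
    with ord show "i u < i v" by (elim disjE) (simp_all add: i i[simplified])
  qed
  moreover have "i u \<in> {1..n}" if "u < 4" for u
    using four[OF that] ord by (elim disjE) (simp_all add: i i[simplified])
  then have "i ` {..<4} \<subseteq> {1..n}" by blast
  moreover have "p (i u) < p (i v) \<longleftrightarrow> [a, b, c, d] ! u < [a, b, c, d] ! v"
    if "u < 4" "v < 4" for u v
    using four[OF that(1)] four[OF that(2)]
    by (elim disjE) (simp_all add: i i[simplified] iff)
  ultimately show ?thesis
    unfolding contains_pattern_def len by (intro exI[of _ i] conjI allI impI)
qed

lemma contains_2143:
  "contains_pattern n p [2,1,4,3] \<longleftrightarrow>
     (\<exists>w x y z. 1 \<le> w \<and> w < x \<and> x < y \<and> y < z \<and> z \<le> n \<and> p x < p w \<and> p w < p z \<and> p z < p y)"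
  (is "_ \<longleftrightarrow> ?R")
proof
  assume "contains_pattern n p [2,1,4,3]"
  then show ?R by (rule contains_pattern_4E) (simp, blast)
next
  assume ?R
  then obtain w x y z where "1 \<le> w" "w < x" "x < y" "y < z" "z \<le> n" "p x < p w" "p w < p z" "p z < p y"
    by blast
  then show "contains_pattern n p [2,1,4,3]" by (intro contains_pattern_4I[of w x y z]) simp_all
qed

lemma contains_3412:
  "contains_pattern n p [3,4,1,2] \<longleftrightarrow>
     (\<exists>w x y z. 1 \<le> w \<and> w < x \<and> x < y \<and> y < z \<and> z \<le> n \<and> p y < p z \<and> p z < p w \<and> p w < p x)"
  (is "_ \<longleftrightarrow> ?R")
proof
  assume "contains_pattern n p [3,4,1,2]"
  then show ?R by (rule contains_pattern_4E) (simp, blast)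
next
  assume ?R
  then obtain w x y z where "1 \<le> w" "w < x" "x < y" "y < z" "z \<le> n" "p y < p z" "p z < p w" "p w < p x"
    by blast
  then show "contains_pattern n p [3,4,1,2]" by (intro contains_pattern_4I[of w x y z]) simp_all
qed

text \<open>The earlier pair, and likewise the later pair, can appear in either order, and the
  smallest letter belongs to either pair. These 2 * 2 * 2 cases are the eight patterns.\<close>

lemma noncrossing_iff_avoids:
  "noncrossing n p \<longleftrightarrow>
     (\<forall>t\<in>{[1,3,2,4], [1,3,4,2], [2,4,1,3], [2,4,3,1],
          [3,1,2,4], [3,1,4,2], [4,2,1,3], [4,2,3,1]}. \<not> contains_pattern n p t)"
    (is "_ \<longleftrightarrow> (\<forall>t\<in>?T. _)")
proof
  assume nc: "noncrossing n p"
  show "\<forall>t\<in>?T. \<not> contains_pattern n p t"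
  proof (intro ballI notI)
    fix t assume "t \<in> ?T" and t: "contains_pattern n p t"
    then obtain a b c d where abcd: "t = [a, b, c, d]" by blast
    from t obtain w x y z where "1 \<le> w" "w < x" "x < y" "y < z" "z \<le> n"
      "p w < p x \<longleftrightarrow> a < b" "p w < p y \<longleftrightarrow> a < c" "p w < p z \<longleftrightarrow> a < d"
      "p x < p w \<longleftrightarrow> b < a" "p x < p y \<longleftrightarrow> b < c" "p x < p z \<longleftrightarrow> b < d"
      "p y < p w \<longleftrightarrow> c < a" "p y < p x \<longleftrightarrow> c < b" "p y < p z \<longleftrightarrow> c < d"
      "p z < p w \<longleftrightarrow> d < a" "p z < p x \<longleftrightarrow> d < b" "p z < p y \<longleftrightarrow> d < c"
      unfolding abcd by (rule contains_pattern_4E)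
    \<comment> \<open>Each pattern orders its first two and its last two entries in some way; one of
      the four instances matches that order.\<close>
    then show False
      using \<open>t \<in> ?T\<close> noncrossingD[OF nc, of w x y z] noncrossingD[OF nc, of x w y z]
        noncrossingD[OF nc, of w x z y] noncrossingD[OF nc, of x w z y]
      unfolding abcd by (elim insertE emptyE) auto
  qed
next
  have cases4: "P \<or> Q \<or> R \<or> S"
    if "w < y" "w < z" "x < y" "x < z" "p w \<noteq> p x" "p y \<noteq> p z"
      "w < x \<Longrightarrow> x < y \<Longrightarrow> y < z \<Longrightarrow> P" "w < x \<Longrightarrow> x < z \<Longrightarrow> z < y \<Longrightarrow> Q"
      "x < w \<Longrightarrow> w < y \<Longrightarrow> y < z \<Longrightarrow> R" "x < w \<Longrightarrow> w < z \<Longrightarrow> z < y \<Longrightarrow> S"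
    for w x y z P Q R S
    using that by (metis linorder_neqE_nat)
  assume av: "\<forall>t\<in>?T. \<not> contains_pattern n p t"
  show "noncrossing n p"
    unfolding noncrossing_def
  proof (intro allI impI conjI notI; elim conjE)
    fix w x y z
    assume pos: "1 \<le> w" "1 \<le> x" "y \<le> n" "z \<le> n" "w < y" "w < z" "x < y" "x < z"
      and val: "p w < p y" "p y < p x" "p x < p z"
    have "contains_pattern n p [1,3,2,4] \<or> contains_pattern n p [1,3,4,2] \<or>
        contains_pattern n p [3,1,2,4] \<or> contains_pattern n p [3,1,4,2]"
    proof (rule cases4[OF pos(5-8)])
      assume "w < x" "x < y" "y < z"
      then show "contains_pattern n p [1,3,2,4]"
        using pos val by (intro contains_pattern_4I[of w x y z]) simp_all
    next
      assume "w < x" "x < z" "z < y"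
      then show "contains_pattern n p [1,3,4,2]"
        using pos val by (intro contains_pattern_4I[of w x z y]) simp_all
    next
      assume "x < w" "w < y" "y < z"
      then show "contains_pattern n p [3,1,2,4]"
        using pos val by (intro contains_pattern_4I[of x w y z]) simp_all
    next
      assume "x < w" "w < z" "z < y"
      then show "contains_pattern n p [3,1,4,2]"
        using pos val by (intro contains_pattern_4I[of x w z y]) simp_all
    qed (use val in auto)
    with av show False by simp
  next
    fix w x y z
    assume pos: "1 \<le> w" "1 \<le> x" "y \<le> n" "z \<le> n" "w < y" "w < z" "x < y" "x < z"
      and val: "p y < p w" "p w < p z" "p z < p x"
    have "contains_pattern n p [2,4,1,3] \<or> contains_pattern n p [2,4,3,1] \<or>
        contains_pattern n p [4,2,1,3] \<or> contains_pattern n p [4,2,3,1]"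
    proof (rule cases4[OF pos(5-8)])
      assume "w < x" "x < y" "y < z"
      then show "contains_pattern n p [2,4,1,3]"
        using pos val by (intro contains_pattern_4I[of w x y z]) simp_all
    next
      assume "w < x" "x < z" "z < y"
      then show "contains_pattern n p [2,4,3,1]"
        using pos val by (intro contains_pattern_4I[of w x z y]) simp_all
    next
      assume "x < w" "w < y" "y < z"
      then show "contains_pattern n p [4,2,1,3]"
        using pos val by (intro contains_pattern_4I[of x w y z]) simp_all
    next
      assume "x < w" "w < z" "z < y"
      then show "contains_pattern n p [4,2,3,1]"
        using pos val by (intro contains_pattern_4I[of x w z y]) simp_all
    qed (use val in auto)
    with av show False by simp
  qed
qed

section \<open>Finding 2143 or 3412 in a noninterlacing word\<close>

lemma noncrossing_contains_2143:
  fixes f :: "nat \<Rightarrow> 'a::linorder"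
  assumes nc: "noncrossing n f" and first: "first_between n f"
    and ijk: "1 \<le> i" "i < j" "j < k" "k \<le> n" "f i < f k" "f k < f j"
    and min: "\<And>i' j' k'. 1 \<le> i' \<Longrightarrow> i' < j' \<Longrightarrow> j' < k' \<Longrightarrow> k' \<le> n \<Longrightarrow>
      f i' < f k' \<and> f k' < f j' \<or> f j' < f k' \<and> f k' < f i' \<Longrightarrow> j \<le> j'"
    and inj: "inj_on f {1..n}"
  shows "\<exists>w x y z. 1 \<le> w \<and> w < x \<and> x < y \<and> y < z \<and> z \<le> n \<and> f x < f w \<and> f w < f z \<and> f z < f y"
proof -
  have neq: "f u \<noteq> f v" if "1 \<le> u" "u < v" "v \<le> n" for u v
    using inj that by (auto dest: inj_onD)
  \<comment> \<open>A later letter above \<open>f j\<close> or below \<open>f i\<close> would,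
    together with \<open>f k\<close>, interlace the earlier pair \<open>f i\<close>,
    \<open>f j\<close>.\<close>
  have after_j: "f i < f l \<and> f l < f j" if "j < l" "l \<le> n" for l
  proof -
    have "f l \<noteq> f i" "f l \<noteq> f j" using neq[of i l] neq[of j l] ijk that by auto
    moreover have "\<not> f j < f l"
      using noncrossingD(1)[OF nc, of i j k l] ijk that by auto
    moreover have "\<not> f l < f i"
      using noncrossingD(2)[OF nc, of i j l k] ijk that by auto
    ultimately show ?thesis by (simp add: not_less_iff_gr_or_eq)
  qed
  \<comment> \<open>Otherwise some \<open>m'\<close> after \<open>j\<close> has its letter between
    \<open>f i\<close> and \<open>f l\<close>: take \<open>m\<close> itself, or \<open>k\<close> if
    \<open>m = j\<close>. The later of the positions \<open>i\<close> and \<open>l\<close>, both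
    before \<open>j\<close>, is then the middle of a triple, against minimality.\<close>
  have below: "f l < f m" if "1 \<le> l" "l < j" "j \<le> m" "m \<le> n" for l m
  proof (rule ccontr)
    assume "\<not> f l < f m"
    then have ml: "f m < f l" using neq[of l m] that by auto
    have "f i < f m" using after_j[of m] ijk that by (cases "m = j") auto
    obtain m' where m': "j < m'" "m' \<le> n" "f i < f m'" "f m' < f l"
    proof (cases "m = j")
      case True
      then have "f k < f l" using ijk ml by simp
      with ijk that show thesis by blast
    qed (use that[of m] ml \<open>f i < f m\<close> \<open>j \<le> m\<close> \<open>m \<le> n\<close> in simp)
    have "j \<le> l" if "i < l"
      by (rule min[of i l m']) (use that ijk m' \<open>l < j\<close> in simp_all)
    moreover have "j \<le> i" if "l < i"
      by (rule min[of l i m']) (use that ijk m' \<open>1 \<le> l\<close> in simp_all)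
    moreover have "i \<noteq> l" using m' by auto
    ultimately show False using ijk \<open>l < j\<close> by linarith
  qed
  obtain a b c where abc: "1 \<le> a" "a < b" "b < c" "c \<le> n"
      "f b < f a \<and> f a < f c \<or> f c < f a \<and> f a < f b"
    using first unfolding first_between_def by blast
  \<comment> \<open>\<open>f j\<close> exceeds every later letter, so it lies between no two of
    them.\<close>
  have "a \<noteq> j" using abc after_j[of b] after_j[of c] by auto
  \<comment> \<open>For \<open>a\<close> after \<open>j\<close>, the letter \<open>f i\<close> is
    below \<open>f b\<close> and \<open>f c\<close>, while \<open>f a\<close> lies between these
    two; so the pair \<open>i\<close>, \<open>a\<close> would interlace the pair \<open>b\<close>,
    \<open>c\<close>.\<close>
  moreover have "\<not> j < a"
  proof
    assume "j < a"
    then show False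
      using abc ijk after_j[of b] after_j[of c] noncrossingD(1)[OF nc, of i a b c]
        noncrossingD(1)[OF nc, of i a c b] by auto
  qed
  ultimately have "a < j" by simp
  obtain d where d: "a < d" "d \<le> n" "f d < f a" using abc by (metis less_imp_le order.trans order.strict_trans)
  have "d < j" using below[of a d] abc(1) \<open>a < j\<close> d by (metis leI less_asym)
  moreover have "f a < f k" using below[of a k] abc \<open>a < j\<close> ijk by simp
  ultimately show ?thesis using abc(1) d ijk by blast
qed

lemma first_last_between_contains:
  fixes p :: "nat \<Rightarrow> nat"
  assumes nc: "noncrossing n p" and first: "first_between n p" and last: "last_between n p"
    and inj: "inj_on p {1..n}"
  shows "contains_pattern n p [2,1,4,3] \<or> contains_pattern n p [3,4,1,2]"
proof -
  let ?L = "\<lambda>i j k. 1 \<le> i \<and> i < j \<and> j < k \<and> k \<le> n \<and>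
      (p i < p k \<and> p k < p j \<or> p j < p k \<and> p k < p i)"
  \<comment> \<open>The minimum is taken over both orientations of a triple, so it survives the
    reversal of the letters.\<close>
  define j where "j = (LEAST j. \<exists>i k. ?L i j k)"
  have "\<exists>j i k. ?L i j k" using last unfolding last_between_def by blast
  then have "\<exists>i k. ?L i j k" unfolding j_def by (rule LeastI_ex)
  then obtain i k where ijk: "?L i j k" by blast
  have min: "j \<le> j'" if "?L i' j' k'" for i' j' k'
    unfolding j_def using that by (intro Least_le) blast
  show ?thesis
  proof (cases "p i < p k")
    case True
    have "\<exists>w x y z. 1 \<le> w \<and> w < x \<and> x < y \<and> y < z \<and> z \<le> n \<and> p x < p w \<and> p w < p z \<and> p z < p y"
    proof (rule noncrossing_contains_2143[OF nc first _ _ _ _ _ _ _ inj])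
      show "1 \<le> i" "i < j" "j < k" "k \<le> n" using ijk by blast+
      show "p i < p k" "p k < p j" using ijk True by auto
    qed (rule min, blast)
    then show ?thesis unfolding contains_2143 by blast
  next
    case False
    \<comment> \<open>Negating the letters, in the integers, swaps the two alternatives of
      \<open>first_between\<close> and, after renaming the positions, the two clauses of
      \<open>noncrossing\<close>. An occurrence of 2143 in \<open>f\<close> is one of 3412 in
      \<open>p\<close> at the same positions.\<close>
    define f where "f = (\<lambda>l. - int (p l))"
    have f_less: "f u < f v \<longleftrightarrow> p v < p u" for u v by (simp add: f_def)
    have "noncrossing n f" using nc unfolding noncrossing_def f_less by blast
    moreover have "first_between n f" using first unfolding first_between_def f_less by blast
    moreover have "f i < f k" "f k < f j" using ijk False by (auto simp: f_less)
    moreover have "inj_on f {1..n}"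
      using inj unfolding f_def inj_on_def by (simp only: neg_equal_iff_equal of_nat_eq_iff)
    moreover have "j \<le> j'" if "1 \<le> i'" "i' < j'" "j' < k'" "k' \<le> n"
      "f i' < f k' \<and> f k' < f j' \<or> f j' < f k' \<and> f k' < f i'" for i' j' k'
      using that by (intro min[of i' j' k']) (auto simp: f_less)
    ultimately have "\<exists>w x y z. 1 \<le> w \<and> w < x \<and> x < y \<and> y < z \<and> z \<le> n \<and>
        f x < f w \<and> f w < f z \<and> f z < f y"
      using ijk by (intro noncrossing_contains_2143[of n f i j k]) blast+
    then show ?thesis unfolding contains_3412 f_less by blast
  qed
qed

section \<open>Order characterizations of intervals and cyclic intervals\<close>

lemma Z_interval_iff:
  assumes "finite A" "A \<noteq> {}"
  shows "Z_interval A \<longleftrightarrow> (\<forall>x\<in>A. \<forall>y\<in>A. \<forall>z. x < z \<and> z < y \<longrightarrow> z \<in> A)"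
proof
  assume A: "\<forall>x\<in>A. \<forall>y\<in>A. \<forall>z. x < z \<and> z < y \<longrightarrow> z \<in> A"
  \<comment> \<open>The endpoints are \<open>Min A\<close> and \<open>Max A\<close>; they belong to
    \<open>A\<close> because it is finite and nonempty, and the assumption covers what lies strictly
    between.\<close>
  have "z \<in> A" if "z \<in> {Min A..Max A}" for z
  proof (cases "z = Min A \<or> z = Max A")
    case False
    with that have "Min A < z" "z < Max A" by auto
    with A Min_in[OF assms] Max_in[OF assms] show ?thesis by blast
  qed (use Min_in[OF assms] Max_in[OF assms] in auto)
  moreover have "A \<subseteq> {Min A..Max A}" using assms by auto
  ultimately have "A = {Min A..Max A}" by blast
  then show "Z_interval A"
    unfolding Z_interval_def using Max_ge[OF assms(1) Min_in[OF assms]] by blast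
qed (auto simp: Z_interval_def)

text \<open>If \<open>A\<close> is not an integer interval, some letter outside it lies between two
  of its letters. Noninterlacing then forces the whole complement between these two and makes it an
  integer interval, so \<open>A\<close> wraps around.\<close>

lemma Zn_interval_iff:
  assumes "A \<subseteq> {1..n}" "A \<noteq> {}"
  shows "Zn_interval n A \<longleftrightarrow>
     (\<forall>a\<in>A. \<forall>b\<in>A. \<forall>c\<in>{1..n} - A. \<forall>d\<in>{1..n} - A.
        \<not> (a < c \<and> c < b \<and> b < d) \<and> \<not> (c < a \<and> a < d \<and> d < b))" (is "_ \<longleftrightarrow> ?nc")
proof
  assume "Zn_interval n A"
  then show ?nc unfolding Zn_interval_def by auto
next
  assume nc: ?nc
  have fin: "finite A" using assms finite_subset by blast
  show "Zn_interval n A"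
  proof (cases "Z_interval A")
    case True
    then obtain a b where ab: "a \<le> b" "A = {a..b}" unfolding Z_interval_def by blast
    then have "a \<in> A" "b \<in> A" by auto
    then have "1 \<le> a" "b \<le> n" using assms by auto
    then show ?thesis unfolding Zn_interval_def using ab by blast
  next
    case False
    define C where "C = {1..n} - A"
    obtain a b c where abc: "a \<in> A" "b \<in> A" "c \<notin> A" "a < c" "c < b"
      using False Z_interval_iff[OF fin assms(2)] by blast
    have "c \<in> C" using abc assms unfolding C_def by auto
    \<comment> \<open>A letter \<open>d\<close> of the complement beyond \<open>b\<close> gives
      \<open>a < c < b < d\<close>, and one before \<open>a\<close> gives
      \<open>d < a < c < b\<close>; both are interlacings.\<close>
    have sub: "a < d \<and> d < b" if "d \<in> C" for d
    proof -
      have "d \<noteq> a" "d \<noteq> b" using that abc unfolding C_def by auto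
      then show ?thesis
        using nc abc \<open>c \<in> C\<close> that unfolding C_def by (metis linorder_neqE_nat)
    qed
    have C: "finite C" "C \<noteq> {}" using \<open>c \<in> C\<close> unfolding C_def by auto
    have "Z_interval C"
      unfolding Z_interval_iff[OF C]
    proof (intro ballI allI impI, rule ccontr)
      \<comment> \<open>A gap \<open>z\<close> in the complement belongs to \<open>A\<close>, and
        \<open>x < z < y < b\<close> is again an interlacing.\<close>
      fix x y z assume xyz: "x \<in> C" "y \<in> C" "x < z \<and> z < y" "z \<notin> C"
      then have "z \<in> A" unfolding C_def by auto
      then show False using nc xyz sub[of y] abc unfolding C_def by blast
    qed
    then obtain u v where uv: "u \<le> v" "C = {u..v}" unfolding Z_interval_def by blast
    then have "u \<in> C" "v \<in> C" by auto
    then have "a < u" "v < b" using sub by auto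
    moreover have "1 \<le> a" "b \<le> n" using abc assms by auto
    moreover have "A = {1..n} - {u..v}" using assms uv unfolding C_def by auto
    \<comment> \<open>Since \<open>a < u\<close> and \<open>v < b\<close>, both outer pieces are
      nonempty, as the wrapped form in \<open>Zn_interval\<close> demands of its endpoints
      \<open>u - 1\<close> and \<open>v + 1\<close>.\<close>
    moreover have "{1..n} - {u..v} = {v + 1..n} \<union> {1..u - 1}"
      using \<open>1 \<le> a\<close> \<open>a < u\<close> \<open>v < b\<close> \<open>b \<le> n\<close> \<open>u \<le> v\<close> by (auto simp: set_eq_iff)
    ultimately have "A = {v + 1..n} \<union> {1..u - 1}" "1 \<le> u - 1" "u - 1 \<le> v + 1" "v + 1 \<le> n"
      using \<open>u \<le> v\<close> by simp_all
    then show ?thesis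
      unfolding Zn_interval_def by (intro exI[of _ "u - 1"] exI[of _ "v + 1"]) simp
  qed
qed

section \<open>Arc and unimodal permutations in terms of letters\<close>

lemma permutes_image_interval_compl:
  fixes j n :: nat
  assumes "p permutes {1..n}" "j \<le> n"
  shows "{1..n} - p ` {1..j} = p ` {j<..n}"
proof -
  have "{1..n} - p ` {1..j} = p ` ({1..n} - {1..j})"
    using assms by (simp add: image_set_diff permutes_inj permutes_image)
  also have "{1..n} - {1..j} = {j<..n}" by auto
  finally show ?thesis .
qed

text \<open>The letters missing from a prefix are those of the remaining suffix, so
  \<open>Zn_interval_iff\<close> at \<open>j\<close> forbids interlacing across the cut after
  \<open>j\<close>. Every two pairs of positions in question are separated by some cut.\<close>

lemma arc_perms_iff: "p \<in> arc_perms n \<longleftrightarrow> p permutes {1..n} \<and> noncrossing n p"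
proof (cases "p permutes {1..n}")
  case True
  have Zn: "Zn_interval n (p ` {1..j}) \<longleftrightarrow>
      (\<forall>w\<in>{1..j}. \<forall>x\<in>{1..j}. \<forall>y\<in>{j<..n}. \<forall>z\<in>{j<..n}.
        \<not> (p w < p y \<and> p y < p x \<and> p x < p z) \<and> \<not> (p y < p w \<and> p w < p z \<and> p z < p x))"
    if "j \<in> {1..n}" for j
  proof -
    have "p ` {1..j} \<subseteq> {1..n}" "p ` {1..j} \<noteq> {}"
      using that permutes_image[OF True] by auto
    from Zn_interval_iff[OF this] show ?thesis
      using permutes_image_interval_compl[OF True, of j] that by simp
  qed
  have "p \<in> arc_perms n \<longleftrightarrow> (\<forall>j\<in>{1..n}. Zn_interval n (p ` {1..j}))"
    using True by (simp add: arc_perms_def Perms_def)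
  also have "\<dots> \<longleftrightarrow> (\<forall>j\<in>{1..n}. \<forall>w\<in>{1..j}. \<forall>x\<in>{1..j}. \<forall>y\<in>{j<..n}. \<forall>z\<in>{j<..n}.
        \<not> (p w < p y \<and> p y < p x \<and> p x < p z) \<and> \<not> (p y < p w \<and> p w < p z \<and> p z < p x))"
    by (rule ball_cong[OF refl Zn])
  also have "\<dots> \<longleftrightarrow> noncrossing n p" (is "?L \<longleftrightarrow> _")
  proof
    assume L: ?L
    show "noncrossing n p"
      unfolding noncrossing_def
    proof (intro allI impI)
      fix w x y z
      assume "1 \<le> w \<and> 1 \<le> x \<and> y \<le> n \<and> z \<le> n \<and> w < y \<and> w < z \<and> x < y \<and> x < z"
      \<comment> \<open>The cut is made right after the earlier pair.\<close>
      then have "max w x \<in> {1..n}" "w \<in> {1..max w x}" "x \<in> {1..max w x}"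
        "y \<in> {max w x<..n}" "z \<in> {max w x<..n}" by auto
      from L[rule_format, OF this]
      show "\<not> (p w < p y \<and> p y < p x \<and> p x < p z) \<and> \<not> (p y < p w \<and> p w < p z \<and> p z < p x)" .
    qed
  next
    assume nc: "noncrossing n p"
    show ?L
    proof (intro ballI)
      fix j w x y z
      assume "w \<in> {1..j}" "x \<in> {1..j}" "y \<in> {j<..n}" "z \<in> {j<..n}"
      then have "1 \<le> w" "1 \<le> x" "y \<le> n" "z \<le> n" "w < y" "w < z" "x < y" "x < z" by auto
      from noncrossingD[OF nc this]
      show "\<not> (p w < p y \<and> p y < p x \<and> p x < p z) \<and> \<not> (p y < p w \<and> p w < p z \<and> p z < p x)" ..
    qed
  qed
  finally show ?thesis using True by simp
qed (auto simp: arc_perms_def Perms_def)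

text \<open>A letter missing between two letters of a prefix still lies in \<open>{1..n}\<close>, so
  it occurs at a later position.\<close>

lemma prefixes_Z_interval_iff:
  assumes p: "p permutes {1..n}"
  shows "(\<forall>j\<in>{1..n}. Z_interval (p ` {1..j})) \<longleftrightarrow> \<not> last_between n p"
proof
  assume Z: "\<forall>j\<in>{1..n}. Z_interval (p ` {1..j})"
  show "\<not> last_between n p"
  proof
    assume "last_between n p"
    then obtain i j k where ijk: "1 \<le> i" "i < j" "j < k" "k \<le> n"
      "p i < p k \<and> p k < p j \<or> p j < p k \<and> p k < p i" unfolding last_between_def by blast
    \<comment> \<open>The prefix ending at the middle position contains the letters at
      \<open>i\<close> and \<open>j\<close> but, by injectivity, not the one at
      \<open>k\<close>.\<close>
    then have "Z_interval (p ` {1..j})" using Z[rule_format, of j] by simp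
    then obtain u v where uv: "p ` {1..j} = {u..v}" unfolding Z_interval_def by blast
    have "p i \<in> {u..v}" "p j \<in> {u..v}" unfolding uv[symmetric] using ijk by simp_all
    then have "p k \<in> {u..v}" using ijk(5) by auto
    then have "k \<in> {1..j}"
      unfolding uv[symmetric] inj_image_mem_iff[OF permutes_inj[OF p]] .
    with ijk show False by simp
  qed
next
  assume L: "\<not> last_between n p"
  show "\<forall>j\<in>{1..n}. Z_interval (p ` {1..j})"
  proof
    fix j assume j: "j \<in> {1..n}"
    then have jn: "j \<le> n" and A: "finite (p ` {1..j})" "p ` {1..j} \<noteq> {}" by auto
    show "Z_interval (p ` {1..j})"
      unfolding Z_interval_iff[OF A]
    proof (intro ballI allI impI, rule ccontr)
      fix x y z assume xyz: "x \<in> p ` {1..j}" "y \<in> p ` {1..j}" "x < z \<and> z < y" "z \<notin> p ` {1..j}"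
      then obtain a b where ab: "a \<in> {1..j}" "b \<in> {1..j}" "x = p a" "y = p b" by blast
      then have "p a \<in> {1..n}" "p b \<in> {1..n}"
        unfolding permutes_in_image[OF p] using j by simp_all
      then have "z \<in> {1..n} - p ` {1..j}" using xyz ab by simp
      then have "z \<in> p ` {j<..n}" unfolding permutes_image_interval_compl[OF p jn] .
      then obtain c where "z = p c" "j < c" "c \<le> n" by auto
      with xyz(3) ab jn have "last_between n p"
        by (intro last_betweenI[of a b c]) simp_all
      with L show False ..
    qed
  qed
qed

text \<open>The mirror image: a letter missing from a suffix occurs at an earlier position.\<close>

lemma suffixes_Z_interval_iff:
  assumes p: "p permutes {1..n}"
  shows "(\<forall>j\<in>{1..n}. Z_interval (p ` {j..n})) \<longleftrightarrow> \<not> first_between n p"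
proof
  assume Z: "\<forall>j\<in>{1..n}. Z_interval (p ` {j..n})"
  show "\<not> first_between n p"
  proof
    assume "first_between n p"
    then obtain i j k where ijk: "1 \<le> i" "i < j" "j < k" "k \<le> n"
      "p j < p i \<and> p i < p k \<or> p k < p i \<and> p i < p j" unfolding first_between_def by blast
    then have "Z_interval (p ` {j..n})" using Z[rule_format, of j] by simp
    then obtain u v where uv: "p ` {j..n} = {u..v}" unfolding Z_interval_def by blast
    have "p j \<in> {u..v}" "p k \<in> {u..v}" unfolding uv[symmetric] using ijk by simp_all
    then have "p i \<in> {u..v}" using ijk(5) by auto
    then have "i \<in> {j..n}"
      unfolding uv[symmetric] inj_image_mem_iff[OF permutes_inj[OF p]] .
    with ijk show False by simp
  qed
next
  assume L: "\<not> first_between n p"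
  show "\<forall>j\<in>{1..n}. Z_interval (p ` {j..n})"
  proof
    fix j assume j: "j \<in> {1..n}"
    then have A: "finite (p ` {j..n})" "p ` {j..n} \<noteq> {}" by auto
    show "Z_interval (p ` {j..n})"
      unfolding Z_interval_iff[OF A]
    proof (intro ballI allI impI, rule ccontr)
      fix x y z assume xyz: "x \<in> p ` {j..n}" "y \<in> p ` {j..n}" "x < z \<and> z < y" "z \<notin> p ` {j..n}"
      then obtain a b where ab: "a \<in> {j..n}" "b \<in> {j..n}" "x = p a" "y = p b" by blast
      then have "p a \<in> {1..n}" "p b \<in> {1..n}"
        unfolding permutes_in_image[OF p] using j by simp_all
      then have "z \<in> p ` {1..n}" unfolding permutes_image[OF p] using xyz(3) ab by simp
      then obtain c where c: "z = p c" "c \<in> {1..n}" by blast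
      with xyz(4) have "c \<notin> {j..n}" by blast
      with c have "z = p c" "c < j" "1 \<le> c" by auto
      with xyz(3) ab have "first_between n p"
        by (intro first_betweenI[of c a b]) simp_all
      with L show False ..
    qed
  qed
qed

section \<open>Comparison of the three classes\<close>

lemma unimodal_perms_iff:
  "p \<in> unimodal_perms n \<longleftrightarrow> p permutes {1..n} \<and> \<not> (last_between n p \<and> first_between n p)"
  using prefixes_Z_interval_iff[of p n] suffixes_Z_interval_iff[of p n]
  unfolding unimodal_perms_def Perms_def mem_Collect_eq by blast

text \<open>When two pairs interlace, each pair has a letter between the two letters of the other.
  This makes unimodal permutations arc permutations.\<close>

lemma crossing_imp_between:
  assumes "\<not> noncrossing n p"
  shows "last_between n p" "first_between n p"
proof -
  obtain w x y z where pos: "1 \<le> w" "1 \<le> x" "y \<le> n" "z \<le> n" "w < y" "w < z" "x < y" "x < z"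
    and "p w < p y \<and> p y < p x \<and> p x < p z \<or> p y < p w \<and> p w < p z \<and> p z < p x"
    using assms unfolding noncrossing_def by blast
  then show "last_between n p" "first_between n p"
    using pos last_betweenI[of w x y n p] last_betweenI[of w x z n p]
      first_betweenI[of x y z n p] first_betweenI[of w y z n p] by blast+
qed

theorem proposition3p4:
  fixes n :: nat
  assumes "n \<ge> 1"
  shows "unimodal_perms n = arc_perms_avoiding n {[2,1,4,3], [3,4,1,2]} \<and>
         arc_perms_avoiding n {[2,1,4,3], [3,4,1,2]} =
           Perms_avoiding n {[1,3,2,4], [1,3,4,2], [2,1,4,3], [2,4,1,3], [2,4,3,1],
                             [3,1,2,4], [3,1,4,2], [3,4,1,2], [4,2,1,3], [4,2,3,1]}"
proof
  have "p \<in> unimodal_perms n \<longleftrightarrow> p \<in> arc_perms_avoiding n {[2,1,4,3], [3,4,1,2]}" for p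
  proof -
    have "last_between n p \<and> first_between n p"
      if "contains_pattern n p [2,1,4,3] \<or> contains_pattern n p [3,4,1,2]"
      using that
    proof
      assume "contains_pattern n p [2,1,4,3]"
      then obtain w x y z where "1 \<le> w" "w < x" "x < y" "y < z" "z \<le> n"
        "p x < p w" "p w < p z" "p z < p y" unfolding contains_2143 by blast
      \<comment> \<open>In 2143 the final 3 lies between 2 and 4, and the initial 2 between 1 and
        3.\<close>
      then show ?thesis using last_betweenI[of w y z n p] first_betweenI[of w x z n p] by simp
    next
      assume "contains_pattern n p [3,4,1,2]"
      then obtain w x y z where "1 \<le> w" "w < x" "x < y" "y < z" "z \<le> n"
        "p y < p z" "p z < p w" "p w < p x" unfolding contains_3412 by blast
      \<comment> \<open>In 3412 the final 2 lies between 1 and 3, and the initial 3 between 1 and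
        4.\<close>
      then show ?thesis using last_betweenI[of y w z n p] first_betweenI[of w y x n p] by simp
    qed
    then show ?thesis
      using first_last_between_contains[of n p] crossing_imp_between[of n p]
        permutes_inj_on[of p "{1..n}" "{1..n}"]
      unfolding unimodal_perms_iff arc_perms_avoiding_def arc_perms_iff mem_Collect_eq by blast
  qed
  then show "unimodal_perms n = arc_perms_avoiding n {[2,1,4,3], [3,4,1,2]}" by blast
  show "arc_perms_avoiding n {[2,1,4,3], [3,4,1,2]} =
           Perms_avoiding n {[1,3,2,4], [1,3,4,2], [2,1,4,3], [2,4,1,3], [2,4,3,1],
                             [3,1,2,4], [3,1,4,2], [3,4,1,2], [4,2,1,3], [4,2,3,1]}"
    \<comment> \<open>Once the arc condition is replaced by its eight patterns, both sides list the
      same ten avoidances in different order.\<close>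
    unfolding arc_perms_avoiding_def arc_perms_iff noncrossing_iff_avoids
      Perms_avoiding_def Perms_def mem_Collect_eq
    by (simp only: ball_simps simp_thms conj_ac)
qed

end
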